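(* Let $\sigma_1,\dots,\sigma_\ell\in\mathbb{R}$ and let $\gamma=(\gamma_q)_{q\geq 1}$ be a sequence with $\gamma_q\in\{\sigma_1,\dots,\sigma_\ell\}$ for all $q$. Let $\psi:\mathbb{N}\to\mathbb{R}_{\geq 0}$ be decreasing with $\sum_{q=1}^\infty\psi(q)=\infty$. Then $\mathrm{m}(W(\psi,\gamma))=1$. Moreover, there exists $\sigma\in\{\sigma_1,\dots,\sigma_\ell\}$ such that $\mathrm{m}(W(\mathbf{1}_{\{\gamma_q=\sigma\}}\psi,\gamma))=1$.
   Context: $\mathbb{N}=\{1,2,3,\dots\}$. "Decreasing" means $\psi(q+1)\leq\psi(q)$ for all $q$. $\|x\|$ denotes the distance from $x\in\mathbb{R}$ to the nearest integer, and $\mathrm{m}$ is Lebesgue measure. For a sequence $\gamma=(\gamma_q)_{q\geq1}$ of real numbers and $\psi:\mathbb{N}\to\mathbb{R}_{\geq 0}$ (not necessarily monotone), $$W(\psi,\gamma)=\{\alpha\in[0,1] : \|q\alpha-\gamma_q\|<\psi(q)\text{ for infinitely many } q\in\mathbb{N}\}.$$ $\mathbf{1}_{\{\gamma_q=\sigma\}}$ denotes the indicator function of the set $\{q\in\mathbb{N}:\gamma_q=\sigma\}$, and $\mathbf{1}_{\{\gamma_q=\sigma\}}\psi$ is the pointwise product. *)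

theory Defs
  imports "HOL-Analysis.Analysis"
begin

(* Sequences indexed by {1,2,3,...} are functions on nat whose value at 0 is never used. *)

definition dist_to_int :: "real \<Rightarrow> real" where
  "dist_to_int x = infdist x \<int>"

definition W :: "(nat \<Rightarrow> real) \<Rightarrow> (nat \<Rightarrow> real) \<Rightarrow> real set" where
  "W \<psi> \<gamma> = {\<alpha> \<in> {0..1}. infinite {q. q \<ge> 1 \<and> dist_to_int (real q * \<alpha> - \<gamma> q) < \<psi> q}}"

end

theory Submission
  imports Defs "HOL-Real_Asymp.Real_Asymp"
begin

text \<open>
  In each window \<open>[2^k, 2^k + 2^(k-h))\<close>, with \<open>h\<close> fixed, some value \<open>s\<close> is taken by \<open>\<gamma>\<close> on a proportion at
  least \<open>1/l\<close>. By Cauchy condensation and the pigeonhole principle, one \<open>s\<close> serves a set of scales \<open>k\<close> on which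
  \<open>2^k * \<psi>(2^(k+1))\<close> still has divergent sum.

  Fix this \<open>s\<close>. Among the points \<open>(a + s)/q\<close> with \<open>q\<close> in the window and \<open>\<gamma> q = s\<close>, discard those that lie unusually
  close to a fraction whose denominator is less than the length of the window. The remaining points are separated
  by a multiple of \<open>4^-k\<close>, and for large \<open>k\<close> every fixed interval \<open>I\<close> still contains at least a constant times \<open>4^k\<close>
  times the length of \<open>I\<close> of them. A second moment estimate for the unions of the balls around these points shows that
  they cover a fixed proportion of every interval, so the union over any tail of scales has null complement.
\<close>

subsection \<open>Counting shifted fractions\<close>

lemma card_int_interval:
  fixes x y :: real
  shows "finite {a::int. x < a \<and> a < y}"
    and "y - x - 1 \<le> card {a::int. x < a \<and> a < y}"
    and "x \<le> y \<Longrightarrow> card {a::int. x < a \<and> a < y} \<le> y - x + 1"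
proof -
  have eq: "{a::int. x < a \<and> a < y} = {\<lfloor>x\<rfloor> + 1 .. \<lceil>y\<rceil> - 1}"
    by (auto; linarith)
  show "finite {a::int. x < a \<and> a < y}" "y - x - 1 \<le> card {a::int. x < a \<and> a < y}"
    "x \<le> y \<Longrightarrow> card {a::int. x < a \<and> a < y} \<le> y - x + 1"
    unfolding eq by (simp_all, linarith+)
qed

text \<open>Cutting \<open>{a..b}\<close> into cells of length \<open>\<delta>\<close> leaves at
  most one point of \<open>S\<close> in each cell, so the cell index is injective on
  \<open>S\<close>.\<close>

lemma separated_card:
  fixes S :: "real set"
  assumes sub: "S \<subseteq> {a..b}" and "a \<le> b" and "\<delta> > 0"
    and sep: "\<And>x y. x \<in> S \<Longrightarrow> y \<in> S \<Longrightarrow> x \<noteq> y \<Longrightarrow> \<delta> \<le> \<bar>x - y\<bar>"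
  shows "finite S" and "card S \<le> (b - a) / \<delta> + 1"
proof -
  let ?f = "\<lambda>x. \<lfloor>(x - a) / \<delta>\<rfloor>"
  have inj: "inj_on ?f S"
  proof (rule inj_onI)
    fix x y assume xy: "x \<in> S" "y \<in> S" "?f x = ?f y"
    have "\<bar>(x - a) / \<delta> - (y - a) / \<delta>\<bar> < 1" using xy(3) by linarith
    moreover have "(x - a) / \<delta> - (y - a) / \<delta> = (x - y) / \<delta>" by (simp add: diff_divide_distrib)
    ultimately have "\<bar>x - y\<bar> < \<delta>" using \<open>\<delta> > 0\<close> by (simp add: abs_divide)
    then show "x = y" using sep[OF xy(1,2)] by fastforce
  qed
  have img: "?f ` S \<subseteq> {0..\<lfloor>(b - a) / \<delta>\<rfloor>}"
  proof
    fix z assume "z \<in> ?f ` S"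
    then obtain x where x: "x \<in> S" "z = ?f x" by auto
    have "a \<le> x" "x \<le> b" using sub x by auto
    then have "0 \<le> (x - a) / \<delta>" "(x - a) / \<delta> \<le> (b - a) / \<delta>"
      using \<open>\<delta> > 0\<close> by (auto simp: divide_right_mono)
    then show "z \<in> {0..\<lfloor>(b - a) / \<delta>\<rfloor>}" using x by (simp add: floor_mono)
  qed
  show "finite S" using inj img finite_imageD finite_subset by blast
  have "card S \<le> card {0..\<lfloor>(b - a) / \<delta>\<rfloor>}"
    using inj img card_inj_on_le by blast
  also have "real \<dots> \<le> (b - a) / \<delta> + 1"
  proof -
    have "0 \<le> (b - a) / \<delta>" using assms by simp
    then show ?thesis by (simp; linarith)
  qed
  finally show "card S \<le> (b - a) / \<delta> + 1" by simp
qed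

text \<open>Being far from all fractions with denominator below \<open>L\<close> is what separates two of these points with
  distinct denominators \<open>q\<close> and \<open>r\<close> in a window of length \<open>L\<close>: if they were close, then \<open>\<bar>q - r\<bar> * x\<close> would
  be close to an integer. Only one target \<open>s\<close> may be used here, because it has to cancel in the difference.\<close>

definition good_points :: "nat \<Rightarrow> nat \<Rightarrow> nat set \<Rightarrow> real \<Rightarrow> real set" where
  "good_points N L Q s = {x. (\<exists>q\<in>Q. \<exists>a::int. real q * x = a + s) \<and>
     (\<forall>u\<in>{1..<L}. \<forall>v::int. 1 / (4 * real N) \<le> \<bar>real u * x - v\<bar>)}"

text \<open>Subtracting the two equations cancels \<open>s\<close> and leaves
  \<open>(q - r) * x - (a - b) = - r * (x - y)\<close>, of modulus below \<open>1 / (4 * N)\<close>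
  because \<open>r < 2 * N\<close>. As \<open>q - r < L\<close>, goodness of \<open>x\<close> forces
  \<open>q = r\<close>. The case \<open>x = y\<close> is included; it shows that a good point has
  only one representation.\<close>

lemma good_points_denominator_unique:
  fixes a b :: int and s :: real
  assumes N: "N \<ge> 1" and L: "L \<le> N" and Q: "Q \<subseteq> {N..<N + L}"
    and x: "x \<in> good_points N L Q s" and "q \<in> Q" "r \<in> Q" "r \<le> q"
    and eqs: "real q * x = a + s" "real r * y = b + s"
    and close: "\<bar>x - y\<bar> < 1 / (8 * real N ^ 2)"
  shows "q = r \<and> a = b"
proof -
  have "q < N + L" "N \<le> r" "r < N + L" using assms by auto
  then have rN: "real r \<le> 2 * real N" "real r > 0" and u: "q - r < L" using L N by linarith+
  have "real r * \<bar>x - y\<bar> < 2 * real N * (1 / (8 * real N ^ 2))"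
    using close rN N by (intro mult_le_less_imp_less) auto
  also have "\<dots> = 1 / (4 * real N)" using N by (simp add: power2_eq_square field_simps)
  finally have small: "real r * \<bar>x - y\<bar> < 1 / (4 * real N)" .
  have "real (q - r) * x - of_int (a - b) = - (real r * (x - y))"
    using eqs \<open>r \<le> q\<close> by (simp add: of_nat_diff algebra_simps)
  then have "\<bar>real (q - r) * x - of_int (a - b)\<bar> = \<bar>real r * (x - y)\<bar>" by simp
  also have "\<dots> = real r * \<bar>x - y\<bar>" by (simp add: abs_mult)
  finally have dist: "\<bar>real (q - r) * x - of_int (a - b)\<bar> < 1 / (4 * real N)" using small by simp
  have "q = r"
  proof (rule ccontr)
    assume "q \<noteq> r"
    then have "q - r \<in> {1..<L}" using \<open>r \<le> q\<close> u by auto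
    then have "1 / (4 * real N) \<le> \<bar>real (q - r) * x - of_int (a - b)\<bar>"
      using x unfolding good_points_def by blast
    then show False using dist by simp
  qed
  moreover have "a = b"
  proof -
    have "\<bar>real_of_int (a - b)\<bar> < 1 / (4 * real N)" using dist \<open>q = r\<close> by (simp add: abs_minus_commute)
    also have "\<dots> \<le> 1" using N by simp
    finally show ?thesis by linarith
  qed
  ultimately show ?thesis by simp
qed

lemma good_points_separated:
  assumes N: "N \<ge> 1" and L: "L \<le> N" and Q: "Q \<subseteq> {N..<N + L}"
    and x: "x \<in> good_points N L Q s" and y: "y \<in> good_points N L Q s" and "x \<noteq> y"
  shows "1 / (8 * real N ^ 2) \<le> \<bar>x - y\<bar>"
proof (rule ccontr)
  assume "\<not> ?thesis"
  then have close: "\<bar>x - y\<bar> < 1 / (8 * real N ^ 2)" "\<bar>y - x\<bar> < 1 / (8 * real N ^ 2)"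
    by (simp_all add: abs_minus_commute)
  obtain q a where qa: "q \<in> Q" "real q * x = of_int a + s" using x by (auto simp: good_points_def)
  obtain r b where rb: "r \<in> Q" "real r * y = of_int b + s" using y by (auto simp: good_points_def)
  \<comment> \<open>Either denominator may be the larger one, so the roles of \<open>x\<close> and
    \<open>y\<close> are taken in both orders.\<close>
  have "q = r \<and> a = b"
    using good_points_denominator_unique[OF N L Q x qa(1) rb(1) _ qa(2) rb(2) close(1)]
      good_points_denominator_unique[OF N L Q y rb(1) qa(1) _ rb(2) qa(2) close(2)]
    by (metis nle_le)
  moreover have "real q > 0" using qa(1) Q N by fastforce
  ultimately have "x = y" using qa rb by (metis mult_cancel_left less_irrefl)
  then show False using \<open>x \<noteq> y\<close> by simp
qed

text \<open>Distinct elements differ by at least \<open>u\<close>, which bounds the count by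
  \<open>L / u + 1\<close>; \<open>u \<le> L\<close> absorbs the additive 1.\<close>

lemma card_residue_class:
  assumes S: "S \<subseteq> {N..<N + L}" and u: "1 \<le> u" "u \<le> L"
    and cong: "\<And>q r. q \<in> S \<Longrightarrow> r \<in> S \<Longrightarrow> int u dvd int q - int r"
  shows "card S \<le> 2 * real L / real u"
proof -
  have sep: "real u \<le> \<bar>x - y\<bar>" if xy: "x \<in> real ` S" "y \<in> real ` S" "x \<noteq> y" for x y
  proof -
    obtain q r where qr: "x = real q" "y = real r" "q \<in> S" "r \<in> S" using xy by auto
    have "int u \<le> \<bar>int q - int r\<bar>"
      using dvd_imp_le_int[of "int q - int r" "int u"] cong[OF qr(3,4)] qr xy by auto
    then show ?thesis using qr by linarith
  qed
  have sub: "real ` S \<subseteq> {real N..real (N + L)}" using S by fastforce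
  have "card S = card (real ` S)" by (simp add: card_image)
  also have "real \<dots> \<le> (real (N + L) - real N) / real u + 1"
    by (rule separated_card(2)[OF sub]) (use u sep in auto)
  also have "\<dots> \<le> 2 * real L / real u" using u by (simp add: field_simps)
  finally show ?thesis by simp
qed

text \<open>Multiplying by \<open>q < 2 * N\<close> turns closeness into
  \<open>\<bar>u * (a + s) - q * v\<bar> < 1 / 2\<close>. The difference for two pairs no longer
  contains \<open>s\<close>, so it is an integer of modulus below 1, hence zero. This gives
  \<open>u * (a - b) = (q - r) * v\<close>, and coprimality puts all denominators in one residue
  class modulo \<open>u\<close>.\<close>

lemma card_near_fraction:
  fixes v :: int
  assumes N: "N \<ge> 1" and L: "L \<le> N" and Q: "Q \<subseteq> {N..<N + L}"
    and u: "1 \<le> u" "u \<le> L" and cop: "coprime (int u) v"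
    and T: "\<And>q a. (q, a) \<in> T \<Longrightarrow> q \<in> Q \<and> \<bar>real u * ((real_of_int a + s) / real q) - v\<bar> < 1 / (4 * real N)"
  shows "card T \<le> 2 * real L / real u"
proof -
  have key: "int u * (a - b) = (int q - int r) * v" if "(q, a) \<in> T" "(r, b) \<in> T" for q r a b
  proof -
    have half: "\<bar>real u * (real_of_int a + s) - real q * v\<bar> < 1 / 2" if "(q, a) \<in> T" for q a
    proof -
      have q: "real q > 0" "real q < 2 * real N" using T[OF that] Q L N by fastforce+
      have "real q * \<bar>real u * ((real_of_int a + s) / real q) - v\<bar> < 2 * real N * (1 / (4 * real N))"
        using T[OF that] q N by (intro mult_less_le_imp_less mult_strict_mono) auto
      moreover have "real q * \<bar>real u * ((real_of_int a + s) / real q) - v\<bar> =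
        \<bar>real q * (real u * ((real_of_int a + s) / real q) - v)\<bar>" using q by (simp add: abs_mult)
      moreover have "real q * (real u * ((real_of_int a + s) / real q) - v) =
        real u * (real_of_int a + s) - real q * v" using q by (simp add: field_simps)
      ultimately show ?thesis using N by simp
    qed
    have "\<bar>real_of_int (int u * (a - b) - (int q - int r) * v)\<bar> < 1"
    proof -
      have "real_of_int (int u * (a - b) - (int q - int r) * v) =
        (real u * (real_of_int a + s) - real q * v) - (real u * (real_of_int b + s) - real r * v)"
        by (simp add: algebra_simps)
      then show ?thesis using half[OF that(1)] half[OF that(2)] by linarith
    qed
    then show ?thesis by linarith
  qed
  \<comment> \<open>By \<open>key\<close>, a denominator determines its numerator, so counting pairs
    amounts to counting denominators.\<close>
  have inj: "inj_on fst T"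
  proof (rule inj_onI, clarify)
    fix q a r b assume t: "(q, a) \<in> T" "(r, b) \<in> T" and "fst (q, a) = fst (r, b)"
    then have "q = r" by simp
    moreover have "a = b" using key[OF t] \<open>q = r\<close> u by simp
    ultimately show "q = r \<and> a = b" by simp
  qed
  have "card T = card (fst ` T)" using inj by (simp add: card_image)
  also have "real \<dots> \<le> 2 * real L / real u"
  proof (rule card_residue_class[of _ N])
    show "fst ` T \<subseteq> {N..<N + L}" using T Q by fastforce
    fix q r assume "q \<in> fst ` T" "r \<in> fst ` T"
    then obtain a b where "(q, a) \<in> T" "(r, b) \<in> T" by auto
    then have "int u dvd (int q - int r) * v" using key by (metis dvd_triv_left)
    then show "int u dvd int q - int r" using cop by (simp add: coprime_dvd_mult_left_iff)
  qed (use u in auto)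
  finally show ?thesis by simp
qed

text \<open>A pair that is close to some fraction is charged to the one with least denominator \<open>u\<close>, which is
  reduced; for a reduced fraction the admissible \<open>q\<close> lie in one residue class modulo \<open>u\<close>.\<close>

lemma card_bad_pairs:
  assumes N: "N \<ge> 1" and L: "L \<le> N" and Q: "Q \<subseteq> {N..<N + L}" and "\<alpha> < \<beta>"
    and T: "\<And>q a. (q, a) \<in> T \<Longrightarrow> q \<in> Q \<and> \<alpha> < (real_of_int a + s) / real q \<and> (real_of_int a + s) / real q < \<beta>"
    and "finite T"
    and bad: "\<And>q a. (q, a) \<in> T \<Longrightarrow>
      \<exists>u\<in>{1..<L}. \<exists>v::int. \<bar>real u * ((real_of_int a + s) / real q) - v\<bar> < 1 / (4 * real N)"
  shows "card T \<le> 2 * real L ^ 2 * (\<beta> - \<alpha>) + 6 * real L * harm L"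
proof -
  \<comment> \<open>The numerators \<open>v\<close> that can occur: \<open>u * x\<close> lies
    between \<open>u * \<alpha>\<close> and \<open>u * \<beta>\<close>, and \<open>v\<close> is
    within \<open>1 / (4 * N) \<le> 1\<close> of it.\<close>
  define V where "V u = {v::int. real u * \<alpha> - 1 < v \<and> v < real u * \<beta> + 1}" for u :: nat
  define F where "F u v = {(q, a). (q, a) \<in> T \<and> coprime (int u) v \<and>
     \<bar>real u * ((real_of_int a + s) / real q) - real_of_int v\<bar> < 1 / (4 * real N)}" for u v
  have finV: "finite (V u)" for u unfolding V_def by (rule card_int_interval)
  have cardV: "card (V u) \<le> real u * (\<beta> - \<alpha>) + 3" for u
  proof -
    have "real u * \<alpha> \<le> real u * \<beta>" using \<open>\<alpha> < \<beta>\<close> by (simp add: mult_left_mono)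
    then have "card (V u) \<le> (real u * \<beta> + 1) - (real u * \<alpha> - 1) + 1"
      unfolding V_def by (intro card_int_interval(3)) linarith
    then show ?thesis by (simp add: algebra_simps)
  qed
  have cardF: "card (F u v) \<le> 2 * real L / real u" if u: "u \<in> {1..<L}" for u v
  proof (cases "coprime (int u) v")
    case True
    show ?thesis by (rule card_near_fraction[OF N L Q _ _ True]) (use u T in \<open>auto simp: F_def\<close>)
  next
    case False
    then show ?thesis by (simp add: F_def)
  qed
  have "T \<subseteq> (\<Union>u\<in>{1..<L}. \<Union>v\<in>V u. F u v)"
  proof (clarify)
    fix q a assume t: "(q, a) \<in> T"
    define x where "x = (real_of_int a + s) / real q"
    define P where "P u \<longleftrightarrow> u \<in> {1..<L} \<and> (\<exists>v::int. \<bar>real u * x - v\<bar> < 1 / (4 * real N))" for u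
    define u where "u = (LEAST u. P u)"
    have "\<exists>u. P u" using bad[OF t] unfolding P_def x_def by blast
    then have Pu: "P u" and least: "\<And>w. P w \<Longrightarrow> u \<le> w" unfolding u_def by (auto intro: LeastI_ex Least_le)
    then obtain v :: int where v: "\<bar>real u * x - v\<bar> < 1 / (4 * real N)" and u: "u \<in> {1..<L}"
      unfolding P_def by auto
    \<comment> \<open>Cancelling a common factor \<open>g\<close> divides the distance by
      \<open>g\<close>, so \<open>u / g\<close> would satisfy \<open>P\<close> too, against
      minimality.\<close>
    have "coprime (int u) v"
    proof (rule ccontr)
      assume nc: "\<not> coprime (int u) v"
      define g where "g = nat (gcd (int u) v)"
      have gi: "int g = gcd (int u) v" by (simp add: g_def)
      have "int g dvd int u" "int g dvd v" unfolding gi by auto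
      then obtain u' v' where uv: "u = g * u'" "v = int g * v'" by (meson dvdE of_nat_dvd_iff)
      have "g \<noteq> 1" using nc gi by (metis coprime_iff_gcd_eq_1 of_nat_1)
      moreover have "g \<noteq> 0" using uv u by auto
      ultimately have g: "g \<ge> 2" by simp
      have u': "1 \<le> u'" "u' < u" using uv u g by (auto intro: Suc_leI)
      have "real u * x - v = real g * (real u' * x - v')" using uv by (simp add: algebra_simps)
      then have "\<bar>real u * x - v\<bar> = real g * \<bar>real u' * x - v'\<bar>" by (simp add: abs_mult)
      moreover have "1 * \<bar>real u' * x - v'\<bar> \<le> real g * \<bar>real u' * x - v'\<bar>"
        using g by (intro mult_right_mono) auto
      ultimately have "P u'" unfolding P_def using u' u v by (auto intro!: exI[of _ v'])
      then show False using least u' by fastforce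
    qed
    then have "(q, a) \<in> F u v" using t v by (simp add: F_def x_def)
    moreover have "v \<in> V u"
    proof -
      have "1 / (4 * real N) \<le> 1" using N by simp
      moreover have "real u * \<alpha> < real u * x" "real u * x < real u * \<beta>"
        using T[OF t] u by (simp_all flip: x_def)
      ultimately show ?thesis using v unfolding V_def by auto
    qed
    ultimately show "(q, a) \<in> (\<Union>u\<in>{1..<L}. \<Union>v\<in>V u. F u v)" using u by blast
  qed
  moreover have "finite (\<Union>u\<in>{1..<L}. \<Union>v\<in>V u. F u v)"
    using finV \<open>finite T\<close> by (auto intro!: finite_subset[of _ T] simp: F_def)
  ultimately have "card T \<le> card (\<Union>u\<in>{1..<L}. \<Union>v\<in>V u. F u v)" by (rule card_mono[rotated])
  also have "\<dots> \<le> (\<Sum>u\<in>{1..<L}. card (\<Union>v\<in>V u. F u v))" by (rule card_UN_le) simp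
  also have "\<dots> \<le> (\<Sum>u\<in>{1..<L}. \<Sum>v\<in>V u. card (F u v))" by (intro sum_mono card_UN_le finV)
  finally have "real (card T) \<le> (\<Sum>u\<in>{1..<L}. \<Sum>v\<in>V u. real (card (F u v)))"
    by (simp flip: of_nat_sum)
  also have "\<dots> \<le> (\<Sum>u\<in>{1..<L}. \<Sum>v\<in>V u. 2 * real L / real u)"
    by (intro sum_mono cardF)
  also have "\<dots> = (\<Sum>u\<in>{1..<L}. card (V u) * (2 * real L / real u))" by simp
  also have "\<dots> \<le> (\<Sum>u\<in>{1..<L}. (real u * (\<beta> - \<alpha>) + 3) * (2 * real L / real u))"
    by (intro sum_mono mult_right_mono cardV) auto
  \<comment> \<open>The first summand is constant in \<open>u\<close> and yields the quadratic term;
    the second yields the harmonic sum.\<close>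
  also have "\<dots> = (\<Sum>u\<in>{1..<L}. 2 * real L * (\<beta> - \<alpha>) + 6 * real L * inverse (real u))"
    by (intro sum.cong) (auto simp: field_simps)
  also have "\<dots> \<le> (\<Sum>u\<in>{1..L}. 2 * real L * (\<beta> - \<alpha>) + 6 * real L * inverse (real u))"
    using \<open>\<alpha> < \<beta>\<close> by (intro sum_mono2) auto
  also have "\<dots> = 2 * real L ^ 2 * (\<beta> - \<alpha>) + 6 * real L * harm L"
    by (simp add: sum.distrib harm_def power2_eq_square flip: sum_distrib_left)
  finally show ?thesis .
qed

text \<open>The pairs with point in the interval number at least
  \<open>L / l * (N * (\<beta> - \<alpha>) - 1)\<close>. From these \<open>card_bad_pairs\<close>
  removes at most \<open>2 * L^2 * (\<beta> - \<alpha>)\<close>, which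
  \<open>4 * l * L \<le> N\<close> keeps below half of the main term, and a harmonic error.\<close>

lemma good_points_card:
  assumes N: "N \<ge> 1" and l: "l \<ge> 1" and lL: "4 * l * L \<le> N"
    and Q: "Q \<subseteq> {N..<N + L}" and QL: "L \<le> l * card Q" and "\<alpha> < \<beta>" and big: "1 \<le> real N * (\<beta> - \<alpha>)"
  shows "real L * (real N * (\<beta> - \<alpha>) / (2 * real l) - 1 - 6 * harm L)
    \<le> card (good_points N L Q s \<inter> {\<alpha><..<\<beta>})"
proof -
  define A where "A q = {a::int. real q * \<alpha> - s < a \<and> a < real q * \<beta> - s}" for q :: nat
  define pt where "pt = (\<lambda>(q, a). (real_of_int a + s) / real q)"
  define T where "T = Sigma Q A"
  define B where "B = {(q, a) \<in> T. \<exists>u\<in>{1..<L}. \<exists>v::int. \<bar>real u * ((real_of_int a + s) / real q) - v\<bar> < 1 / (4 * real N)}"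
  have "1 * L \<le> 4 * l * L" using l by (intro mult_right_mono) auto
  then have LN: "L \<le> N" using lL by linarith
  have finQ: "finite Q" using Q finite_subset by blast
  have finA: "finite (A q)" for q unfolding A_def by (rule card_int_interval)
  have finT: "finite T" unfolding T_def using finQ finA by auto
  have Qpos: "real q > 0" if "q \<in> Q" for q using that Q N by fastforce
  have Tint: "q \<in> Q \<and> \<alpha> < (real_of_int a + s) / real q \<and> (real_of_int a + s) / real q < \<beta>" if "(q, a) \<in> T" for q a
    using that Qpos[of q] unfolding T_def A_def by (auto simp: field_simps)
  have "real L / real l \<le> card Q" using QL l by (simp add: divide_le_eq mult.commute flip: of_nat_mult)
  \<comment> \<open>The hypothesis \<open>big\<close> makes the common factor nonnegative, so the
    lower bound for \<open>card Q\<close> may be inserted.\<close>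
  then have "real L / real l * (real N * (\<beta> - \<alpha>) - 1) \<le> card Q * (real N * (\<beta> - \<alpha>) - 1)"
    using big by (intro mult_right_mono) auto
  also have "\<dots> = (\<Sum>q\<in>Q. real N * (\<beta> - \<alpha>) - 1)" by simp
  also have "\<dots> \<le> (\<Sum>q\<in>Q. real (card (A q)))"
  proof (rule sum_mono)
    fix q assume "q \<in> Q"
    then have "real N \<le> real q" using Q by auto
    then have "real N * (\<beta> - \<alpha>) \<le> real q * (\<beta> - \<alpha>)" using \<open>\<alpha> < \<beta>\<close> by (intro mult_right_mono) auto
    also have "\<dots> - 1 \<le> card (A q)"
      using card_int_interval(2)[of "real q * \<beta> - s" "real q * \<alpha> - s"] by (simp add: A_def algebra_simps)
    finally show "real N * (\<beta> - \<alpha>) - 1 \<le> card (A q)" by simp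
  qed
  also have "\<dots> = card T" unfolding T_def using finQ finA by (simp add: card_SigmaI)
  finally have cT: "real L / real l * (real N * (\<beta> - \<alpha>) - 1) \<le> card T" .
  have BT: "B \<subseteq> T" unfolding B_def by auto
  have cB: "card B \<le> 2 * real L ^ 2 * (\<beta> - \<alpha>) + 6 * real L * harm L"
    by (rule card_bad_pairs[OF N LN Q \<open>\<alpha> < \<beta>\<close>])
      (use Tint BT finT in \<open>auto simp: B_def intro: finite_subset\<close>)
  have img: "pt ` (T - B) \<subseteq> good_points N L Q s \<inter> {\<alpha><..<\<beta>}"
  proof (clarify)
    fix q a assume t: "(q, a) \<in> T" and nb: "(q, a) \<notin> B"
    have "q \<in> Q" using Tint[OF t] by simp
    moreover have "real q * ((real_of_int a + s) / real q) = a + s" using Qpos[OF \<open>q \<in> Q\<close>] by simp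
    moreover have "\<forall>u\<in>{1..<L}. \<forall>v::int. 1 / (4 * real N) \<le> \<bar>real u * ((real_of_int a + s) / real q) - v\<bar>"
      using nb t unfolding B_def by (auto simp: not_less)
    ultimately have "(real_of_int a + s) / real q \<in> good_points N L Q s"
      unfolding good_points_def by blast
    then show "pt (q, a) \<in> good_points N L Q s \<inter> {\<alpha><..<\<beta>}" using Tint[OF t] by (simp add: pt_def)
  qed
  \<comment> \<open>Different pairs could give the same real number; for good points the uniqueness
    lemma at distance zero excludes this.\<close>
  have inj: "inj_on pt (T - B)"
  proof (rule inj_onI, clarify)
    fix q a r b
    assume t: "(q, a) \<in> T" "(r, b) \<in> T" and nb: "(q, a) \<notin> B" "(r, b) \<notin> B" and e: "pt (q, a) = pt (r, b)"
    define x where "x = pt (q, a)"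
    have x: "x \<in> good_points N L Q s" using img t nb unfolding x_def by blast
    have Q2: "q \<in> Q" "r \<in> Q" using Tint t by auto
    have xr: "x = pt (r, b)" using e by (simp add: x_def)
    have eqs: "real q * x = a + s" "real r * x = b + s"
      using Qpos[OF Q2(1)] by (simp add: x_def pt_def) (use Qpos[OF Q2(2)] in \<open>simp add: xr pt_def\<close>)
    have z: "\<bar>x - x\<bar> < 1 / (8 * real N ^ 2)" using N by simp
    show "q = r \<and> a = b"
      using good_points_denominator_unique[OF N LN Q x Q2 _ eqs z]
        good_points_denominator_unique[OF N LN Q x Q2(2,1) _ eqs(2,1) z] by (metis nle_le)
  qed
  have "finite (good_points N L Q s \<inter> {\<alpha><..<\<beta>})"
    by (rule separated_card(1)[of _ \<alpha> \<beta> "1 / (8 * real N ^ 2)"])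
      (use good_points_separated[OF N LN Q] N \<open>\<alpha> < \<beta>\<close> in auto)
  then have "card (T - B) \<le> card (good_points N L Q s \<inter> {\<alpha><..<\<beta>})"
    using inj img card_inj_on_le by blast
  moreover have "real (card (T - B)) = card T - card B"
    using BT finT by (simp add: card_Diff_subset finite_subset card_mono of_nat_diff)
  moreover have "real L * (real N * (\<beta> - \<alpha>) / (2 * real l) - 1 - 6 * harm L)
    \<le> real L / real l * (real N * (\<beta> - \<alpha>) - 1) - (2 * real L ^ 2 * (\<beta> - \<alpha>) + 6 * real L * harm L)"
  proof -
    have "real (4 * l * L) \<le> real N" using lL by (rule of_nat_mono)
    then have "2 * real L \<le> real N / (2 * real l)" using l by (simp add: field_simps)
    then have b1: "real L * (\<beta> - \<alpha>) * (2 * real L) \<le> real L * (\<beta> - \<alpha>) * (real N / (2 * real l))"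
      using \<open>\<alpha> < \<beta>\<close> by (intro mult_left_mono) auto
    have b2: "real L / real l \<le> real L" using l by (simp add: divide_le_eq mult_le_cancel_left1)
    have e1: "real L / real l * (real N * (\<beta> - \<alpha>) - 1) =
      2 * (real L * (\<beta> - \<alpha>) * (real N / (2 * real l))) - real L / real l"
      using l by (simp add: field_simps)
    have e2: "real L * (real N * (\<beta> - \<alpha>) / (2 * real l) - 1 - 6 * harm L) =
      real L * (\<beta> - \<alpha>) * (real N / (2 * real l)) - real L - 6 * real L * harm L"
      by (simp add: algebra_simps)
    have e3: "2 * real L ^ 2 * (\<beta> - \<alpha>) = real L * (\<beta> - \<alpha>) * (2 * real L)"
      by (simp add: power2_eq_square)
    have "z \<le> x \<Longrightarrow> y \<le> y' \<Longrightarrow> x - y' - w \<le> 2 * x - y - (z + w)" for x y y' z w :: real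
      by linarith
    from this[OF b1 b2] show ?thesis unfolding e1 e2 e3 .
  qed
  ultimately show ?thesis using cT cB by linarith
qed

section \<open>Dyadic windows at large scales\<close>

lemma harm_le_ln:
  assumes "n \<ge> 1"
  shows "harm n \<le> 1 + ln (real n)"
proof -
  obtain m where m: "n = Suc m" using assms by (cases n) auto
  have "harm (Suc m) - ln (Suc m) \<le> harm (Suc 0) - ln (real (Suc 0))"
    using decseqD[OF decseq_harm_diff_ln, of 0 m] by simp
  then show ?thesis by (simp add: m harm_expand)
qed

text \<open>The harmonic error grows linearly in \<open>k\<close> while
  \<open>2^k * (\<beta> - \<alpha>)\<close> grows exponentially, so eventually half of the main term
  survives. The threshold for \<open>k\<close> depends on the interval but is uniform in
  \<open>Q\<close> and \<open>s\<close>.\<close>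

lemma good_points_dyadic_card:
  assumes l: "l \<ge> 1" and h: "4 * l \<le> 2 ^ h" and "\<alpha> < \<beta>"
  shows "\<forall>\<^sub>F k in sequentially. \<forall>Q s. Q \<subseteq> {2 ^ k..<2 ^ k + 2 ^ (k - h)} \<longrightarrow> 2 ^ (k - h) \<le> l * card Q \<longrightarrow>
    1 / (4 * real l * 2 ^ h) * 4 ^ k * (\<beta> - \<alpha>) \<le> card (good_points (2 ^ k) (2 ^ (k - h)) Q s \<inter> {\<alpha><..<\<beta>})"
proof -
  have p: "(\<beta> - \<alpha>) / (4 * real l) > 0" using l \<open>\<alpha> < \<beta>\<close> by simp
  have "\<forall>\<^sub>F k in sequentially. 7 + 6 * (real k * ln 2) \<le> 2 ^ k * ((\<beta> - \<alpha>) / (4 * real l))"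
    using p by real_asymp
  \<comment> \<open>From here on \<open>k - h\<close> is not truncated, so
    \<open>2^k = 2^h * 2^(k - h)\<close>.\<close>
  moreover have "\<forall>\<^sub>F k in sequentially. k \<ge> h" by (rule eventually_ge_at_top)
  ultimately show ?thesis
  proof eventually_elim
    case (elim k)
    define N :: nat where "N = 2 ^ k"
    define L :: nat where "L = 2 ^ (k - h)"
    have NL: "N = 2 ^ h * L" using elim by (simp add: N_def L_def flip: power_add)
    have L1: "L \<ge> 1" and N1: "N \<ge> 1" by (simp_all add: L_def N_def)
    have lL: "4 * l * L \<le> N" using h by (simp add: NL)
    \<comment> \<open>The eventual inequality was chosen for this bound:
      \<open>1 + 6 * (1 + k * ln 2)\<close> is its left-hand side.\<close>
    have "harm L \<le> 1 + ln (real L)" by (rule harm_le_ln[OF L1])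
    also have "\<dots> = 1 + real (k - h) * ln 2" by (simp add: L_def ln_realpow)
    also have "\<dots> \<le> 1 + real k * ln 2" by simp
    finally have "1 + 6 * harm L \<le> real N * ((\<beta> - \<alpha>) / (4 * real l))" using elim by (simp add: N_def)
    then have m: "real N * (\<beta> - \<alpha>) / (4 * real l) \<le> real N * (\<beta> - \<alpha>) / (2 * real l) - 1 - 6 * harm L"
      by (simp add: field_simps)
    have "1 \<le> real N * ((\<beta> - \<alpha>) / (4 * real l))" using elim by (simp add: N_def) (smt (verit) ln_ge_zero mult_nonneg_nonneg of_nat_0_le_iff)
    also have "\<dots> \<le> real N * ((\<beta> - \<alpha>) / 1)"
      using l \<open>\<alpha> < \<beta>\<close> by (intro mult_left_mono divide_left_mono) auto
    also have "\<dots> = real N * (\<beta> - \<alpha>)" by simp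
    finally have big: "1 \<le> real N * (\<beta> - \<alpha>)" .
    have "1 / (4 * real l * 2 ^ h) * 4 ^ k * (\<beta> - \<alpha>) = real L * (real N * (\<beta> - \<alpha>) / (4 * real l))"
    proof -
      have "(4::real) ^ k = real N * real N" by (simp add: N_def flip: power_mult_distrib)
      also have "\<dots> = real N * 2 ^ h * real L" by (simp add: NL)
      finally show ?thesis by simp
    qed
    also have "\<dots> \<le> real L * (real N * (\<beta> - \<alpha>) / (2 * real l) - 1 - 6 * harm L)"
      using m by (intro mult_left_mono) auto
    finally show ?case using good_points_card[OF N1 l lL _ _ \<open>\<alpha> < \<beta>\<close> big] unfolding N_def L_def
      by (meson order_trans)
  qed
qed

subsection \<open>From a proportion of every interval to full measure\<close>

text \<open>A covering argument: if the complement had measure \<open>m > 0\<close> in a box, almost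
  economical nonoverlapping intervals would cover that part. It fills at most the proportion
  \<open>1 - c\<close> of each of them, so \<open>m\<close> would be smaller than itself. It is
  essential that \<open>c\<close> is the same for all intervals.\<close>

lemma negligible_Compl_if_interval_density:
  fixes T :: "real set"
  assumes T: "T \<in> sets lebesgue" and "c > 0"
    and dens: "\<And>a b. a < b \<Longrightarrow> c * (b - a) \<le> measure lebesgue (T \<inter> {a<..<b})"
  shows "negligible (- T)"
proof (subst negligible_on_intervals, intro allI)
  fix a b :: real
  define Z where "Z = - T \<inter> cbox a b"
  define m where "m = measure lebesgue Z"
  have CT: "- T \<in> sets lebesgue" using T by (simp add: Compl_in_sets_lebesgue)
  have Z: "Z \<in> lmeasurable" unfolding Z_def
    by (subst Int_commute, rule fmeasurable_Int_fmeasurable[OF lmeasurable_cbox CT])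
  then have Zs: "Z \<in> sets lebesgue" by (rule fmeasurableD)
  \<comment> \<open>Ensures \<open>1 - c \<ge> 0\<close> for the monotonicity steps below.\<close>
  have c1: "c \<le> 1"
  proof -
    have "c * (1 - 0) \<le> measure lebesgue (T \<inter> {0<..<1})" using dens[of 0 1] by simp
    also have "\<dots> \<le> measure lebesgue {0<..<1::real}"
      by (rule measure_mono_fmeasurable) (use T in auto)
    finally show ?thesis by simp
  qed
  have part: "measure lebesgue (Z \<inter> {u..v}) \<le> (1 - c) * measure lebesgue {u..v}" for u v
  proof (cases "u < v")
    case True
    have TZ: "T \<inter> {u<..<v} \<in> lmeasurable" "Z \<inter> {u..v} \<in> lmeasurable"
      by (subst Int_commute, rule fmeasurable_Int_fmeasurable, use T in simp_all)
        (rule fmeasurable_Int_fmeasurable[OF Z], simp)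
    have "Z \<inter> {u..v} - T \<inter> {u<..<v} = Z \<inter> {u..v}" by (auto simp: Z_def)
    then have "measure lebesgue (T \<inter> {u<..<v}) + measure lebesgue (Z \<inter> {u..v}) =
      measure lebesgue ((T \<inter> {u<..<v}) \<union> (Z \<inter> {u..v}))"
      using measure_Un2[OF TZ] by simp
    also have "\<dots> \<le> measure lebesgue {u..v}"
      by (rule measure_mono_fmeasurable) (use TZ[THEN fmeasurableD] in auto)
    finally show ?thesis using dens[OF True] True by (simp add: algebra_simps)
  next
    \<comment> \<open>The boxes of the covering may degenerate to points; then both sides
      vanish.\<close>
    case False
    have "measure lebesgue (Z \<inter> {u..v}) \<le> measure lebesgue {u..v}"
      by (rule measure_mono_fmeasurable) (use Zs in auto)
    also have "\<dots> = 0" using False by (cases "u = v") auto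
    finally show ?thesis using False by (cases "u = v") auto
  qed
  have "m = 0"
  proof (rule ccontr)
    assume "m \<noteq> 0"
    then have m: "m > 0" by (simp add: m_def zero_less_measure_iff)
    \<comment> \<open>Two errors of size \<open>e\<close> arise, from the covering and from its
      finite subfamily; together they cost only half of the gain \<open>c * m\<close>.\<close>
    define e where "e = c * m / 4"
    have e: "e > 0" using m \<open>c > 0\<close> by (simp add: e_def)
    obtain \<D> where D: "countable \<D>"
        "\<And>K. K \<in> \<D> \<Longrightarrow> K \<subseteq> cbox a b \<and> K \<noteq> {} \<and> (\<exists>c d. K = cbox c d)"
        "pairwise (\<lambda>A B. interior A \<inter> interior B = {}) \<D>"
        "Z \<subseteq> \<Union>\<D>" "\<Union>\<D> \<in> lmeasurable" "measure lebesgue (\<Union>\<D>) \<le> measure lebesgue Z + e"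
      by (rule measurable_outer_intervals_bounded[OF Z _ e, of a b]) (auto simp: Z_def)
    have DM: "K \<in> lmeasurable" if "K \<in> \<D>" for K using D(2)[OF that] by auto
    have Ds: "\<Union>\<D> \<in> sets lebesgue" by (rule fmeasurableD[OF D(5)])
    obtain F where F: "F \<subseteq> \<D>" "finite F" "measure lebesgue (\<Union>\<D>) - e < measure lebesgue (\<Union>F)"
    proof (rule measure_countable_Union_approachable[OF D(1) e DM])
      fix D' assume "D' \<subseteq> \<D>" "finite D'"
      then show "measure lebesgue (\<Union>D') \<le> measure lebesgue (\<Union>\<D>)"
        by (intro measure_mono_fmeasurable[OF _ _ D(5)] fmeasurableD[OF fmeasurable.finite_Union] Union_mono)
          (use DM in blast)+
    qed
    have FM: "\<Union>F \<in> lmeasurable" by (intro fmeasurable.finite_Union) (use F DM in blast)+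
    then have Fs: "\<Union>F \<in> sets lebesgue" by (rule fmeasurableD)
    have sub: "\<Union>F \<subseteq> \<Union>\<D>" using F(1) by blast
    have "measure lebesgue (Z \<inter> \<Union>F) \<le> (\<Sum>K\<in>F. measure lebesgue (Z \<inter> K))"
      unfolding Int_Union
      by (rule measure_UNION_le[OF F(2)]) (use Zs fmeasurableD[OF DM] F(1) in \<open>intro sets.Int; blast\<close>)
    also have "\<dots> \<le> (\<Sum>K\<in>F. (1 - c) * measure lebesgue K)"
    proof (rule sum_mono)
      fix K assume "K \<in> F"
      then obtain u v where "K = {u..v}" using D(2)[of K] F(1) by auto
      then show "measure lebesgue (Z \<inter> K) \<le> (1 - c) * measure lebesgue K" using part by simp
    qed
    also have "\<dots> = (1 - c) * measure lebesgue (\<Union>F)"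
    proof -
      \<comment> \<open>Intersections of the boxes are convex with empty interior, hence null, so
        the measures add up.\<close>
      have "pairwise (\<lambda>S T. negligible (S \<inter> T)) F"
      proof (rule pairwiseI)
        fix S T assume "S \<in> F" "T \<in> F" "S \<noteq> T"
        then have ST: "S \<in> \<D>" "T \<in> \<D>" using F(1) by auto
        have "interior S \<inter> interior T = {}" using pairwiseD[OF D(3) ST \<open>S \<noteq> T\<close>] .
        moreover have "convex S" "convex T" using D(2)[OF ST(1)] D(2)[OF ST(2)] by auto
        ultimately show "negligible (S \<inter> T)" by (simp add: negligible_convex_interior convex_Int)
      qed
      then have "measure lebesgue (\<Union>F) = sum (measure lebesgue) F"
        by (intro measure_negligible_finite_Union) (use F DM in blast)+
      then show ?thesis by (simp add: sum_distrib_left)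
    qed
    also have "\<dots> \<le> (1 - c) * measure lebesgue (\<Union>\<D>)"
      by (intro mult_left_mono measure_mono_fmeasurable[OF sub Fs D(5)]) (use c1 in simp)
    also have "\<dots> \<le> (1 - c) * (m + e)" using D(6) c1 by (intro mult_left_mono) (auto simp: m_def)
    finally have 1: "measure lebesgue (Z \<inter> \<Union>F) \<le> (1 - c) * (m + e)" .
    \<comment> \<open>What the finite subfamily misses of \<open>Z\<close> lies in the remainder of
      the covering, of measure less than \<open>e\<close>.\<close>
    have "m \<le> measure lebesgue ((Z \<inter> \<Union>F) \<union> (\<Union>\<D> - \<Union>F))"
      unfolding m_def
      by (intro measure_mono_fmeasurable[OF _ Zs] fmeasurable.Un fmeasurable.Diff[OF D(5) FM]
          fmeasurable_Int_fmeasurable[OF Z Fs]) (use D(4) in blast)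
    also have "\<dots> \<le> measure lebesgue (Z \<inter> \<Union>F) + measure lebesgue (\<Union>\<D> - \<Union>F)"
      by (intro measure_Un_le sets.Int sets.Diff Zs Fs Ds)
    also have "measure lebesgue (\<Union>\<D> - \<Union>F) = measure lebesgue (\<Union>\<D>) - measure lebesgue (\<Union>F)"
      by (intro measurable_measure_Diff[OF D(5) Fs sub])
    finally have "m < (1 - c) * (m + e) + e" using 1 F(3) by linarith
    moreover have "(1 - c) * (m + e) + e = m - 2 * (c * m / 4) - c * e" unfolding e_def by (simp add: field_simps)
    moreover have "c * e > 0" "c * m / 4 > 0" using e \<open>c > 0\<close> m by auto
    ultimately show False by linarith
  qed
  then show "negligible (- T \<inter> cbox a b)" using Z by (simp add: negligible_iff_measure0 m_def Z_def)
qed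

text \<open>If \<open>S\<close> counts the sets containing a point, then
  \<open>2 * t * S - t^2 * S^2 = 1 - (1 - t * S)^2\<close> is at most 1 on the union and 0 outside
  it; integrate. Optimizing \<open>t\<close> gives the Chung-Erdos inequality, and leaving it free
  avoids division.\<close>

lemma second_moment_bound:
  fixes E :: "'i \<Rightarrow> 'a set" and t :: real
  assumes A: "finite A" and E: "\<And>i. i \<in> A \<Longrightarrow> E i \<in> fmeasurable M"
  shows "2 * t * (\<Sum>i\<in>A. measure M (E i)) - t ^ 2 * (\<Sum>i\<in>A. \<Sum>j\<in>A. measure M (E i \<inter> E j))
    \<le> measure M (\<Union>i\<in>A. E i)"
proof -
  let ?f = "\<lambda>x. 2 * t * (\<Sum>i\<in>A. indicator (E i) x) - t ^ 2 * (\<Sum>i\<in>A. \<Sum>j\<in>A. indicator (E i \<inter> E j) x) :: real"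
  have "has_bochner_integral M ?f
    (2 * t * (\<Sum>i\<in>A. measure M (E i)) - t ^ 2 * (\<Sum>i\<in>A. \<Sum>j\<in>A. measure M (E i \<inter> E j)))"
    using E fmeasurable.Int[of _ M]
    by (intro has_bochner_integral_diff has_bochner_integral_mult_right has_bochner_integral_sum
      has_bochner_integral_real_indicator) (force simp: fmeasurable_def)+
  moreover have "has_bochner_integral M (indicator (\<Union>i\<in>A. E i) :: 'a \<Rightarrow> real) (measure M (\<Union>i\<in>A. E i))"
    using fmeasurable.finite_UN[OF A, of E M] E
    by (intro has_bochner_integral_real_indicator) (auto simp: fmeasurable_def)
  moreover have "?f x \<le> indicator (\<Union>i\<in>A. E i) x" for x
  proof -
    define S :: real where "S = (\<Sum>i\<in>A. indicator (E i) x)"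
    have "(\<Sum>i\<in>A. \<Sum>j\<in>A. indicator (E i \<inter> E j) x) = S ^ 2"
      by (simp add: S_def power2_eq_square sum_product indicator_inter_arith)
    then have f: "?f x = 2 * t * S - t ^ 2 * S ^ 2" by (simp add: S_def)
    show ?thesis
    proof (cases "x \<in> (\<Union>i\<in>A. E i)")
      case True
      have "0 \<le> (1 - t * S) ^ 2" by simp
      then show ?thesis unfolding f using True by (simp add: power2_eq_square algebra_simps)
    next
      case False
      then have "S = 0" unfolding S_def by (intro sum.neutral) auto
      then show ?thesis unfolding f by simp
    qed
  qed
  ultimately show ?thesis
    by (metis (no_types, lifting) has_bochner_integral_iff integral_mono)
qed

section \<open>Divergent sums, geometric sums and unions of balls\<close>

lemma partial_sum_ge_one_if_not_summable:
  fixes e :: "nat \<Rightarrow> real"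
  assumes "\<And>k. 0 \<le> e k" and "\<not> summable e"
  obtains m where "n \<le> m" "1 \<le> sum e {n..<m}"
proof -
  obtain m where m: "1 + sum e {..<n} < sum e {..<m}"
    using assms by (meson not_less summableI_nonneg_bounded)
  have "n \<le> m"
  proof (rule ccontr)
    assume "\<not> n \<le> m"
    then have "sum e {..<m} \<le> sum e {..<n}" using assms by (intro sum_mono2) auto
    then show False using m by simp
  qed
  moreover have "sum e {..<m} = sum e {..<n} + sum e {n..<m}"
    using sum.atLeastLessThan_concat[of 0 n m e] \<open>n \<le> m\<close> by (simp add: atLeast0LessThan)
  ultimately show thesis using m that by simp
qed

lemma sum_power4_atMost: "(\<Sum>j\<le>k. 4 ^ j :: real) \<le> 2 * 4 ^ k"
proof -
  have "3 * (\<Sum>j\<le>k. 4 ^ j :: real) + 1 = 4 * 4 ^ k"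
    by (induction k) (auto simp: algebra_simps)
  moreover have "(0::real) \<le> 4 ^ k" by simp
  ultimately show ?thesis by linarith
qed

text \<open>Each pair is charged to its larger index \<open>k\<close>, where the powers
  \<open>4^j\<close> with \<open>j \<le> k\<close> sum to at most \<open>2 * 4^k\<close>. The two
  orders of a pair double this.\<close>

lemma sum_min_max_bound:
  fixes \<rho> :: "nat \<Rightarrow> real"
  assumes "finite A" and \<rho>: "\<And>k. 0 \<le> \<rho> k"
  shows "(\<Sum>j\<in>A. \<Sum>k\<in>A. 4 ^ min j k * \<rho> (max j k)) \<le> 4 * (\<Sum>k\<in>A. 4 ^ k * \<rho> k)"
proof -
  let ?g = "\<lambda>j k. if j \<le> k then 4 ^ j * \<rho> k else 0"
  have inner: "(\<Sum>j\<in>A. ?g j k) \<le> 2 * (4 ^ k * \<rho> k)" for k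
  proof -
    have "(\<Sum>j\<in>A. ?g j k) = (\<Sum>j\<in>A \<inter> {..k}. 4 ^ j) * \<rho> k"
      using assms(1) by (simp add: sum.inter_restrict sum_distrib_right if_distrib if_distribR cong: if_cong)
    also have "\<dots> \<le> (\<Sum>j\<le>k. 4 ^ j) * \<rho> k"
      using \<rho> by (intro mult_right_mono sum_mono2) auto
    also have "\<dots> \<le> 2 * 4 ^ k * \<rho> k" using \<rho> sum_power4_atMost[of k]
      by (intro mult_right_mono) auto
    finally show ?thesis by simp
  qed
  have "(\<Sum>j\<in>A. \<Sum>k\<in>A. 4 ^ min j k * \<rho> (max j k)) \<le> (\<Sum>j\<in>A. \<Sum>k\<in>A. ?g j k + ?g k j)"
    using \<rho> by (intro sum_mono) (auto simp: min_def max_def)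
  also have "\<dots> = (\<Sum>j\<in>A. \<Sum>k\<in>A. ?g j k) + (\<Sum>j\<in>A. \<Sum>k\<in>A. ?g k j)" by (simp add: sum.distrib)
  also have "(\<Sum>j\<in>A. \<Sum>k\<in>A. ?g j k) = (\<Sum>j\<in>A. \<Sum>k\<in>A. ?g k j)" by (rule sum.swap)
  also have "\<dots> + \<dots> \<le> (\<Sum>j\<in>A. 2 * (4 ^ j * \<rho> j)) + (\<Sum>j\<in>A. 2 * (4 ^ j * \<rho> j))"
    by (intro add_mono sum_mono inner)
  also have "\<dots> = 4 * (\<Sum>k\<in>A. 4 ^ k * \<rho> k)" by (simp flip: sum_distrib_left)
  finally show ?thesis .
qed

lemma measure_UN_balls_le:
  fixes R :: "real set" and r :: real
  assumes "finite R" "0 \<le> r"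
  shows "measure lebesgue (\<Union>x\<in>R. ball x r) \<le> card R * (2 * r)"
proof -
  have "measure lebesgue (\<Union>x\<in>R. ball x r) \<le> (\<Sum>x\<in>R. measure lebesgue (ball x r))"
    by (rule measure_UNION_le) (use assms in auto)
  also have "\<dots> = card R * (2 * r)" using assms by (simp add: ball_eq_greaterThanLessThan)
  finally show ?thesis .
qed

lemma measure_UN_balls_eq:
  fixes R :: "real set" and r :: real
  assumes "finite R" "0 \<le> r" and sep: "\<And>x y. x \<in> R \<Longrightarrow> y \<in> R \<Longrightarrow> x \<noteq> y \<Longrightarrow> 2 * r \<le> \<bar>x - y\<bar>"
  shows "measure lebesgue (\<Union>x\<in>R. ball x r) = card R * (2 * r)"
proof -
  have "pairwise (\<lambda>x y. disjnt (ball x r) (ball y r)) R"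
  proof (rule pairwiseI)
    fix x y assume "x \<in> R" "y \<in> R" "x \<noteq> y"
    then have "2 * r \<le> \<bar>x - y\<bar>" by (rule sep)
    then show "disjnt (ball x r) (ball y r)" by (auto simp: disjnt_iff dist_real_def)
  qed
  then have "measure lebesgue (\<Union>x\<in>R. ball x r) = (\<Sum>x\<in>R. measure lebesgue (ball x r))"
    by (intro measure_UNION') (use assms in auto)
  also have "\<dots> = card R * (2 * r)" using assms by (simp add: ball_eq_greaterThanLessThan)
  finally show ?thesis .
qed

text \<open>Write \<open>e k = 4^k * \<rho> k\<close>. The balls of level \<open>k\<close> have
  total measure of order at least \<open>e k\<close> in the interval. For \<open>j \<le> k\<close>,
  each ball of level \<open>j\<close> meets at most about \<open>4^k * \<rho> j + 1\<close> balls of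
  level \<open>k\<close>, so overlaps are of order \<open>e j * e k + 4^j * \<rho> k\<close>. Once
  the sum \<open>S\<close> of the \<open>e k\<close> reaches 1, the second moment is of order
  \<open>S^2\<close>, and the bound is free of \<open>n\<close>.\<close>

lemma ubiquity_interval_density:
  fixes P :: "nat \<Rightarrow> real set" and \<rho> :: "nat \<Rightarrow> real"
  assumes "c > 0"
    and sep: "\<And>k x y. k \<in> K \<Longrightarrow> x \<in> P k \<Longrightarrow> y \<in> P k \<Longrightarrow> x \<noteq> y \<Longrightarrow> 1 / (8 * 4 ^ k) \<le> \<bar>x - y\<bar>"
    and many: "\<And>\<alpha> \<beta>. \<alpha> < \<beta> \<Longrightarrow> \<forall>\<^sub>F k in sequentially. k \<in> K \<longrightarrow> c * 4 ^ k * (\<beta> - \<alpha>) \<le> card (P k \<inter> {\<alpha><..<\<beta>})"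
    and \<rho>: "\<And>k. 0 \<le> \<rho> k" "\<And>k. \<rho> k \<le> 1 / (32 * 4 ^ k)"
    and div: "\<not> summable (\<lambda>k. if k \<in> K then 4 ^ k * \<rho> k else 0)"
    and "\<alpha> < \<beta>"
  shows "c\<^sup>2 / 240 * (\<beta> - \<alpha>) \<le> measure lebesgue ((\<Union>k\<in>K \<inter> {n..}. \<Union>x\<in>P k. ball x (\<rho> k)) \<inter> {\<alpha><..<\<beta>})"
proof -
  define w where "w = \<beta> - \<alpha>"
  \<comment> \<open>The margins of \<open>w / 4\<close> keep balls centred in the inner interval
    inside the given one.\<close>
  define a b where "a = \<alpha> + w / 4" and "b = \<beta> - w / 4"
  have w: "w > 0" "b - a = w / 2" "a < b" using \<open>\<alpha> < \<beta>\<close> by (auto simp: w_def a_def b_def field_simps)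
  have "\<forall>\<^sub>F k in sequentially. 1 / (4::real) ^ k < w"
    using order_tendstoD(2)[OF LIMSEQ_power_zero[of "1/4::real"], of w] w by (simp add: power_divide)
  moreover have "\<forall>\<^sub>F k in sequentially. k \<in> K \<longrightarrow> c * 4 ^ k * (b - a) \<le> card (P k \<inter> {a<..<b})"
    using w by (intro many) auto
  moreover have "\<forall>\<^sub>F k in sequentially. n \<le> k" by (rule eventually_ge_at_top)
  ultimately have "\<forall>\<^sub>F k in sequentially. 1 / (4::real) ^ k < w \<and> n \<le> k \<and>
      (k \<in> K \<longrightarrow> c * 4 ^ k * (b - a) \<le> card (P k \<inter> {a<..<b}))"
    by eventually_elim auto
  then obtain n0 where n0: "\<And>k. n0 \<le> k \<Longrightarrow> 1 / (4::real) ^ k < w \<and> n \<le> k \<and>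
      (k \<in> K \<longrightarrow> c * 4 ^ k * (b - a) \<le> card (P k \<inter> {a<..<b}))"
    unfolding eventually_sequentially by blast
  define e where "e k = 4 ^ k * \<rho> k" for k
  have e0: "e k \<ge> 0" for k using \<rho> by (simp add: e_def)
  obtain m where m: "1 \<le> (\<Sum>k\<in>{n0..<m}. if k \<in> K then e k else 0)"
    by (rule partial_sum_ge_one_if_not_summable[of "\<lambda>k. if k \<in> K then e k else 0"])
      (use div e0 in \<open>auto simp: e_def cong: if_cong\<close>)
  define A where "A = {n0..<m} \<inter> K"
  define S where "S = sum e A"
  have S1: "S \<ge> 1" using m by (simp add: S_def A_def sum.inter_restrict)
  have finA: "finite A" by (simp add: A_def)
  define R where "R k = P k \<inter> {a<..<b}" for k
  define E where "E k = (\<Union>x\<in>R k. ball x (\<rho> k))" for k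
  have sepR: "1 / (8 * 4 ^ k) \<le> \<bar>x - y\<bar>" if "k \<in> A" "x \<in> R k" "y \<in> R k" "x \<noteq> y" for k x y
    using sep[of k x y] that by (auto simp: A_def R_def)
  have Rab: "R k \<subseteq> {a..b}" for k by (auto simp: R_def)
  have finR: "finite (R k)" if "k \<in> A" for k
    by (rule separated_card(1)[OF Rab _ _ sepR]) (use w that in auto)
  \<comment> \<open>This absorbs the additive 1 in \<open>cardR\<close> and bounds the radii by the
    margin \<open>w / 4\<close>.\<close>
  have large: "1 \<le> w * 4 ^ k" if "k \<in> A" for k
    using n0[of k] that by (simp add: A_def divide_less_eq)
  have cardR: "card (R k) \<le> 5 * w * 4 ^ k" if "k \<in> A" for k
  proof -
    have "card (R k) \<le> (b - a) / (1 / (8 * 4 ^ k)) + 1"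
      by (rule separated_card(2)[OF Rab _ _ sepR]) (use w that in auto)
    then show ?thesis using large[OF that] by (simp add: w)
  qed
  have Elm: "E k \<in> lmeasurable" if "k \<in> A" for k
    unfolding E_def by (rule fmeasurable.finite_UN) (use finR[OF that] in auto)
  have mE: "measure lebesgue (E k) = card (R k) * (2 * \<rho> k)" if "k \<in> A" for k
  proof -
    \<comment> \<open>The cap on \<open>\<rho>\<close> makes the balls of one level disjoint, so
      their measures add exactly.\<close>
    have "2 * \<rho> k \<le> 1 / (8 * 4 ^ k)" using \<rho>(2)[of k] by (simp add: field_simps)
    then have "2 * \<rho> k \<le> \<bar>x - y\<bar>" if "x \<in> R k" "y \<in> R k" "x \<noteq> y" for x y
      using sepR[OF \<open>k \<in> A\<close> that] by linarith
    then show ?thesis unfolding E_def by (intro measure_UN_balls_eq finR that \<rho>)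
  qed
  have lower: "c * w * e k \<le> measure lebesgue (E k)" if "k \<in> A" for k
  proof -
    have "c * 4 ^ k * (w / 2) \<le> card (R k)" using n0[of k] that w by (simp add: A_def R_def)
    then have "c * 4 ^ k * (w / 2) * (2 * \<rho> k) \<le> card (R k) * (2 * \<rho> k)"
      using \<rho> by (intro mult_right_mono) auto
    then show ?thesis by (simp add: mE[OF that] e_def mult_ac)
  qed
  have overlap_less: "measure lebesgue (E j \<inter> E k) \<le> w * (160 * e j * e k + 20 * (4 ^ j * \<rho> k))"
    if jk: "j \<in> A" "k \<in> A" for j k
  proof -
    \<comment> \<open>The centres of level \<open>k\<close> whose balls can meet the ball of level
      \<open>j\<close> around \<open>y\<close>.\<close>
    define C where "C y = R k \<inter> cball y (\<rho> j + \<rho> k)" for y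
    have cardC: "card (C y) \<le> 16 * 4 ^ k * \<rho> j + 2" for y
    proof -
      have "card (C y) \<le> ((y + (\<rho> j + \<rho> k)) - (y - (\<rho> j + \<rho> k))) / (1 / (8 * 4 ^ k)) + 1"
        by (rule separated_card(2)) (use \<rho> sepR[OF jk(2)] in \<open>auto simp: C_def cball_eq_atLeastAtMost\<close>)
      also have "\<dots> = 16 * 4 ^ k * \<rho> j + 16 * 4 ^ k * \<rho> k + 1" by (simp add: algebra_simps)
      also have "16 * 4 ^ k * \<rho> k \<le> 1" using \<rho>(2)[of k] by (simp add: field_simps)
      finally show ?thesis by simp
    qed
    have sub: "E j \<inter> E k \<subseteq> (\<Union>y\<in>R j. \<Union>x\<in>C y. ball x (\<rho> k))"
    proof
      fix z assume "z \<in> E j \<inter> E k"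
      then obtain y x where "y \<in> R j" "x \<in> R k" "dist y z < \<rho> j" "dist x z < \<rho> k"
        by (auto simp: E_def)
      moreover from this have "x \<in> C y"
        using dist_triangle2[of y x z] by (simp add: C_def)
      ultimately show "z \<in> (\<Union>y\<in>R j. \<Union>x\<in>C y. ball x (\<rho> k))" by auto
    qed
    have finC: "finite (C y)" for y using finR[OF jk(2)] by (simp add: C_def)
    have lm: "(\<Union>y\<in>R j. \<Union>x\<in>C y. ball x (\<rho> k)) \<in> lmeasurable"
      using finR[OF jk(1)] finC by (intro fmeasurable.finite_UN) auto
    have "measure lebesgue (E j \<inter> E k) \<le> measure lebesgue (\<Union>y\<in>R j. \<Union>x\<in>C y. ball x (\<rho> k))"
      by (rule measure_mono_fmeasurable[OF sub _ lm]) (intro sets.Int fmeasurableD Elm jk)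
    also have "\<dots> \<le> (\<Sum>y\<in>R j. measure lebesgue (\<Union>x\<in>C y. ball x (\<rho> k)))"
      by (rule measure_UNION_le[OF finR[OF jk(1)]]) (use finC in auto)
    also have "\<dots> \<le> (\<Sum>y\<in>R j. card (C y) * (2 * \<rho> k))"
      using finC \<rho> by (intro sum_mono measure_UN_balls_le) auto
    also have "\<dots> \<le> (\<Sum>y\<in>R j. (16 * 4 ^ k * \<rho> j + 2) * (2 * \<rho> k))"
      using cardC \<rho> by (intro sum_mono mult_right_mono) auto
    also have "\<dots> = card (R j) * ((16 * 4 ^ k * \<rho> j + 2) * (2 * \<rho> k))" by simp
    also have "\<dots> \<le> 5 * w * 4 ^ j * ((16 * 4 ^ k * \<rho> j + 2) * (2 * \<rho> k))"
      using cardR[OF jk(1)] \<rho> by (intro mult_right_mono) auto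
    also have "\<dots> = w * (160 * e j * e k + 20 * (4 ^ j * \<rho> k))" by (simp add: e_def algebra_simps)
    finally show ?thesis .
  qed
  \<comment> \<open>The previous bound holds in either order; using it with the smaller index first
    keeps its last term summable by \<open>sum_min_max_bound\<close>.\<close>
  have overlap: "measure lebesgue (E j \<inter> E k) \<le> w * (160 * e j * e k + 20 * (4 ^ min j k * \<rho> (max j k)))"
    if jk: "j \<in> A" "k \<in> A" for j k
  proof (cases "j \<le> k")
    case True
    then show ?thesis using overlap_less[OF jk] by (simp add: min_def max_def)
  next
    case False
    then show ?thesis using overlap_less[OF jk(2,1)] by (simp add: min_def max_def Int_commute mult_ac)
  qed
  have "(\<Sum>j\<in>A. \<Sum>k\<in>A. measure lebesgue (E j \<inter> E k))
    \<le> (\<Sum>j\<in>A. \<Sum>k\<in>A. w * (160 * e j * e k + 20 * (4 ^ min j k * \<rho> (max j k))))"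
    by (intro sum_mono overlap)
  also have "\<dots> = w * (160 * S\<^sup>2 + 20 * (\<Sum>j\<in>A. \<Sum>k\<in>A. 4 ^ min j k * \<rho> (max j k)))"
  proof -
    have "S\<^sup>2 = (\<Sum>j\<in>A. \<Sum>k\<in>A. e j * e k)" by (simp add: S_def power2_eq_square sum_product)
    then show ?thesis by (simp add: sum.distrib sum_distrib_left distrib_left mult.assoc)
  qed
  also have "\<dots> \<le> w * (160 * S\<^sup>2 + 20 * (4 * S))"
    using sum_min_max_bound[OF finA, of \<rho>] \<rho> w by (intro mult_left_mono) (auto simp: S_def e_def)
  \<comment> \<open>Here \<open>S \<ge> 1\<close> lets the linear term be absorbed:
    \<open>160 + 80 = 240\<close>.\<close>
  also have "\<dots> \<le> w * (240 * S\<^sup>2)"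
    using S1 w by (intro mult_left_mono) (auto simp: power2_eq_square)
  finally have second: "(\<Sum>j\<in>A. \<Sum>k\<in>A. measure lebesgue (E j \<inter> E k)) \<le> w * (240 * S\<^sup>2)" .
  have first: "c * w * S \<le> (\<Sum>k\<in>A. measure lebesgue (E k))"
    unfolding S_def sum_distrib_left by (intro sum_mono lower)
  \<comment> \<open>the optimal parameter for the two bounds above\<close>
  define t where "t = c / (240 * S)"
  have t: "t > 0" using S1 \<open>c > 0\<close> by (simp add: t_def)
  have "c\<^sup>2 / 240 * w = 2 * t * (c * w * S) - t\<^sup>2 * (w * (240 * S\<^sup>2))"
    using S1 by (simp add: t_def field_simps power2_eq_square)
  also have "\<dots> \<le> 2 * t * (\<Sum>k\<in>A. measure lebesgue (E k)) - t\<^sup>2 * (\<Sum>j\<in>A. \<Sum>k\<in>A. measure lebesgue (E j \<inter> E k))"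
    using first second t by (intro diff_mono mult_left_mono) auto
  also have "\<dots> \<le> measure lebesgue (\<Union>k\<in>A. E k)"
    using finA Elm by (rule second_moment_bound)
  also have "\<dots> \<le> measure lebesgue ((\<Union>k\<in>K \<inter> {n..}. \<Union>x\<in>P k. ball x (\<rho> k)) \<inter> {\<alpha><..<\<beta>})"
  proof (rule measure_mono_fmeasurable)
    have "ball x (\<rho> k) \<subseteq> {\<alpha><..<\<beta>}" if "k \<in> A" "x \<in> R k" for k x
    proof -
      have "\<rho> k \<le> 1 / (32 * 4 ^ k)" by (rule \<rho>)
      also have "\<dots> \<le> w / 4" using large[OF that(1)] by (simp add: field_simps)
      finally show ?thesis using that(2) by (auto simp: R_def a_def b_def dist_real_def)
    qed
    moreover have "k \<in> K \<inter> {n..}" if "k \<in> A" for k using n0[of k] that by (auto simp: A_def)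
    ultimately show "(\<Union>k\<in>A. E k) \<subseteq> (\<Union>k\<in>K \<inter> {n..}. \<Union>x\<in>P k. ball x (\<rho> k)) \<inter> {\<alpha><..<\<beta>}"
      unfolding E_def R_def by blast
    show "(\<Union>k\<in>A. E k) \<in> sets lebesgue" using Elm finA by (intro sets.finite_UN fmeasurableD) auto
    have "open (\<Union>k\<in>K \<inter> {n..}. \<Union>x\<in>P k. ball x (\<rho> k))" by (intro open_UN ballI open_ball)
    then show "(\<Union>k\<in>K \<inter> {n..}. \<Union>x\<in>P k. ball x (\<rho> k)) \<inter> {\<alpha><..<\<beta>} \<in> lmeasurable"
      by (intro lmeasurable_open open_Int) (auto intro: bounded_Int)
  qed
  finally show ?thesis by (simp add: w_def)
qed

text \<open>The density constant is the same for every tail, so each tail union is conull, and so is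
  their countable intersection.\<close>

lemma ubiquity_negligible:
  fixes P :: "nat \<Rightarrow> real set" and \<rho> :: "nat \<Rightarrow> real"
  assumes "c > 0"
    and sep: "\<And>k x y. k \<in> K \<Longrightarrow> x \<in> P k \<Longrightarrow> y \<in> P k \<Longrightarrow> x \<noteq> y \<Longrightarrow> 1 / (8 * 4 ^ k) \<le> \<bar>x - y\<bar>"
    and many: "\<And>\<alpha> \<beta>. \<alpha> < \<beta> \<Longrightarrow> \<forall>\<^sub>F k in sequentially. k \<in> K \<longrightarrow> c * 4 ^ k * (\<beta> - \<alpha>) \<le> card (P k \<inter> {\<alpha><..<\<beta>})"
    and \<rho>: "\<And>k. 0 \<le> \<rho> k" "\<And>k. \<rho> k \<le> 1 / (32 * 4 ^ k)"
    and div: "\<not> summable (\<lambda>k. if k \<in> K then 4 ^ k * \<rho> k else 0)"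
  shows "negligible (- (\<Inter>n. \<Union>k\<in>K \<inter> {n..}. \<Union>x\<in>P k. ball x (\<rho> k)))"
proof -
  have "negligible (- (\<Union>k\<in>K \<inter> {n..}. \<Union>x\<in>P k. ball x (\<rho> k)))" for n
  proof (rule negligible_Compl_if_interval_density)
    have "open (\<Union>k\<in>K \<inter> {n..}. \<Union>x\<in>P k. ball x (\<rho> k))" by (intro open_UN ballI open_ball)
    then show "(\<Union>k\<in>K \<inter> {n..}. \<Union>x\<in>P k. ball x (\<rho> k)) \<in> sets lebesgue" by simp
    show "c\<^sup>2 / 240 > 0" using \<open>c > 0\<close> by simp
  qed (rule ubiquity_interval_density[OF assms])
  then have "negligible (\<Union>n. - (\<Union>k\<in>K \<inter> {n..}. \<Union>x\<in>P k. ball x (\<rho> k)))"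
    by (intro negligible_countable_Union) auto
  then show ?thesis by (simp only: Compl_INT)
qed

subsection \<open>Choice of the target\<close>

lemma dist_to_int_le: "dist_to_int x \<le> \<bar>x - of_int a\<bar>"
  unfolding dist_to_int_def using infdist_le[of "of_int a" \<int> x] by (simp add: dist_real_def)

text \<open>Summable terms tend to zero, so the cap \<open>C\<close> is eventually inactive; Cauchy
  condensation then makes \<open>\<psi>\<close> summable.\<close>

lemma not_summable_condensed_min:
  fixes \<psi> :: "nat \<Rightarrow> real"
  assumes nonneg: "\<And>q. q \<ge> 1 \<Longrightarrow> \<psi> q \<ge> 0"
    and decreasing: "\<And>q. q \<ge> 1 \<Longrightarrow> \<psi> (q + 1) \<le> \<psi> q"
    and diverges: "filterlim (\<lambda>N. \<Sum>q=1..N. \<psi> q) at_top sequentially" and "C > 0"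
  shows "\<not> summable (\<lambda>k. min (2 ^ k * \<psi> (2 ^ Suc k)) C)"
proof
  assume sm: "summable (\<lambda>k. min (2 ^ k * \<psi> (2 ^ Suc k)) C)"
  \<comment> \<open>The condensation test is applied to a function on all of \<open>nat\<close>,
    while nothing is known about \<open>\<psi> 0\<close>.\<close>
  define \<psi>' where "\<psi>' q = (if q = 0 then 0 else \<psi> q)" for q
  have "\<forall>\<^sub>F k in sequentially. min (2 ^ k * \<psi> (2 ^ Suc k)) C < C"
    using summable_LIMSEQ_zero[OF sm] \<open>C > 0\<close> by (rule order_tendstoD)
  then have "\<forall>\<^sub>F k in sequentially. min (2 ^ k * \<psi> (2 ^ Suc k)) C = 2 ^ k * \<psi>' (2 ^ Suc k)"
    by eventually_elim (auto simp: min_def \<psi>'_def split: if_splits)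
  then have "summable (\<lambda>k. 2 ^ k * \<psi>' (2 ^ Suc k))" using sm by (rule summable_cong[THEN iffD1])
  then have "summable (\<lambda>k. 2 * (2 ^ k * \<psi>' (2 ^ Suc k)))" by (rule summable_mult)
  then have "summable (\<lambda>k. 2 ^ Suc k * \<psi>' (2 ^ Suc k))" by (simp add: mult.assoc)
  then have "summable (\<lambda>k. 2 ^ k * \<psi>' (2 ^ k))" by (subst (asm) summable_Suc_iff)
  moreover have "summable \<psi>' \<longleftrightarrow> summable (\<lambda>k. 2 ^ k * \<psi>' (2 ^ k))"
    by (rule condensation_test) (use nonneg decreasing in \<open>auto simp: \<psi>'_def\<close>)
  ultimately have s: "summable \<psi>'" by simp
  have "eventually (\<lambda>N. suminf \<psi>' + 1 \<le> (\<Sum>q=1..N. \<psi> q)) sequentially"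
    using diverges by (simp add: filterlim_at_top)
  then obtain N where "suminf \<psi>' + 1 \<le> (\<Sum>q=1..N. \<psi> q)" by (auto simp: eventually_sequentially)
  also have "\<dots> = (\<Sum>q=1..N. \<psi>' q)" by (intro sum.cong) (auto simp: \<psi>'_def)
  also have "\<dots> \<le> suminf \<psi>'" by (intro sum_le_suminf s) (use nonneg in \<open>auto simp: \<psi>'_def\<close>)
  finally show False by simp
qed

lemma pigeonhole_fiber:
  fixes l :: nat
  assumes "finite J" "finite S" "S \<noteq> {}" "card S \<le> l" and \<gamma>: "\<And>q. q \<in> J \<Longrightarrow> \<gamma> q \<in> S"
  shows "\<exists>s\<in>S. card J \<le> l * card {q \<in> J. \<gamma> q = s}"
proof (rule ccontr)
  assume "\<not> ?thesis"
  then have less: "\<And>s. s \<in> S \<Longrightarrow> l * card {q \<in> J. \<gamma> q = s} < card J" by auto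
  have "l * card J = (\<Sum>s\<in>S. l * card {q \<in> J. \<gamma> q = s})"
  proof -
    have "card J = (\<Sum>s\<in>S. card {q \<in> J. \<gamma> q = s})"
      using sum.group[OF assms(1,2) image_subsetI[OF \<gamma>], where h = "\<lambda>_. 1::nat"] by simp
    then show ?thesis by (simp add: sum_distrib_left)
  qed
  also have "\<dots> < (\<Sum>s\<in>S. card J)" using less assms by (intro sum_strict_mono) auto
  also have "\<dots> \<le> l * card J" using \<open>card S \<le> l\<close> by (simp add: mult_right_mono)
  finally show False by simp
qed

text \<open>The finitely many restrictions of \<open>e\<close> add up to \<open>e\<close>, so they
  cannot all be summable.\<close>

lemma not_summable_fiber:
  fixes e :: "nat \<Rightarrow> real"
  assumes "finite S" and \<tau>: "\<And>k. \<tau> k \<in> S" and "\<not> summable e"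
  shows "\<exists>s\<in>S. \<not> summable (\<lambda>k. if \<tau> k = s then e k else 0)"
proof (rule ccontr)
  assume "\<not> ?thesis"
  then have "summable (\<lambda>k. \<Sum>s\<in>S. if \<tau> k = s then e k else 0)" by (intro summable_sum) auto
  moreover have "(\<Sum>s\<in>S. if \<tau> k = s then e k else 0) = e k" for k
    using assms by (simp add: sum.delta')
  ultimately show False using assms by simp
qed

section \<open>Full measure in the unit interval\<close>

lemma emeasure_lebesgue_unit_interval_eq_1:
  assumes "A \<subseteq> {0..1::real}" and "negligible ({0..1} - A)"
  shows "emeasure lebesgue A = 1"
proof -
  have N: "{0..1} - A \<in> null_sets lebesgue" using assms(2) by (simp add: negligible_iff_null_sets)
  have "emeasure lebesgue A = emeasure lebesgue ({0..1} - ({0..1} - A))"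
    using assms(1) by (simp add: double_diff)
  also have "\<dots> = emeasure lebesgue {0..1::real}" by (rule emeasure_Diff_null_set[OF N]) simp
  finally show ?thesis by simp
qed

theorem corollary4:
  fixes \<sigma> :: "nat \<Rightarrow> real" and l :: nat
    and \<gamma> :: "nat \<Rightarrow> real" and \<psi> :: "nat \<Rightarrow> real"
  assumes gamma_values: "\<And>q. q \<ge> 1 \<Longrightarrow> \<gamma> q \<in> \<sigma> ` {1..l}"
    and psi_nonneg: "\<And>q. q \<ge> 1 \<Longrightarrow> \<psi> q \<ge> 0"
    and psi_decreasing: "\<And>q. q \<ge> 1 \<Longrightarrow> \<psi> (q + 1) \<le> \<psi> q"
    and psi_diverges: "filterlim (\<lambda>N. \<Sum>q=1..N. \<psi> q) at_top sequentially"
  shows "emeasure lebesgue (W \<psi> \<gamma>) = 1 \<and>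
    (\<exists>s \<in> \<sigma> ` {1..l}.
       emeasure lebesgue (W (\<lambda>q. indicator {q. q \<ge> 1 \<and> \<gamma> q = s} q * \<psi> q) \<gamma>) = 1)"
proof -
  let ?S = "\<sigma> ` {1..l}"
  have l: "l \<ge> 1" using gamma_values[of 1] by auto
  obtain h :: nat where h: "4 * l \<le> 2 ^ h" using less_exp[of "4 * l"] by (meson less_imp_le)
  define J where "J k = {2 ^ k..<2 ^ k + 2 ^ (k - h) :: nat}" for k
  have "\<exists>s\<in>?S. card (J k) \<le> l * card {q \<in> J k. \<gamma> q = s}" for k
  proof (rule pigeonhole_fiber)
    \<comment> \<open>Only an inequality, as \<open>\<sigma>\<close> may repeat values.\<close>
    show "card ?S \<le> l" using card_image_le[of "{1..l}" \<sigma>] by simp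
    fix q assume "q \<in> J k"
    then have "2 ^ k \<le> q" by (simp add: J_def)
    then have "1 \<le> q" using one_le_power[of "2::nat" k] by linarith
    then show "\<gamma> q \<in> ?S" by (rule gamma_values)
  qed (use l in \<open>auto simp: J_def\<close>)
  then obtain \<tau> where \<tau>: "\<And>k. \<tau> k \<in> ?S" "\<And>k. card (J k) \<le> l * card {q \<in> J k. \<gamma> q = \<tau> k}"
    by metis
  \<comment> \<open>The first entry is at most \<open>\<psi> q / q\<close> throughout the window,
    since \<open>q \<le> 2^(k+1)\<close> and \<open>\<psi>\<close> decreases. The second is the cap
    required by the ubiquity lemma; after multiplication by \<open>2 * 4^k\<close> it becomes
    \<open>1 / 16\<close>.\<close>
  define \<rho> where "\<rho> k = min (\<psi> (2 ^ Suc k) / 2 ^ Suc k) (1 / (32 * 4 ^ k))" for k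
  have \<rho>: "0 \<le> \<rho> k" "\<rho> k \<le> 1 / (32 * 4 ^ k)" for k
    using psi_nonneg[of "2 ^ Suc k"] by (simp_all add: \<rho>_def)
  have "2 * (4 ^ k * \<rho> k) = min (2 ^ k * \<psi> (2 ^ Suc k)) (1 / 16)" for k
  proof -
    have "2 * (4 ^ k * \<rho> k) = min (2 * 4 ^ k * (\<psi> (2 ^ Suc k) / 2 ^ Suc k)) (2 * 4 ^ k * (1 / (32 * 4 ^ k)))"
      unfolding \<rho>_def by (subst min_mult_distrib_left) (simp add: mult.assoc)
    also have "2 * 4 ^ k * (\<psi> (2 ^ Suc k) / 2 ^ Suc k) = 2 ^ k * \<psi> (2 ^ Suc k)"
      by (simp add: field_simps flip: power_mult_distrib)
    finally show ?thesis by simp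
  qed
  then have "\<not> summable (\<lambda>k. 2 * (4 ^ k * \<rho> k))"
    using not_summable_condensed_min[OF psi_nonneg psi_decreasing psi_diverges, of "1 / 16"] by simp
  then have "\<not> summable (\<lambda>k. 4 ^ k * \<rho> k)" using summable_mult by blast
  then obtain s where s: "s \<in> ?S" "\<not> summable (\<lambda>k. if \<tau> k = s then 4 ^ k * \<rho> k else 0)"
    using not_summable_fiber[of ?S \<tau> "\<lambda>k. 4 ^ k * \<rho> k"] \<tau>(1) by auto
  \<comment> \<open>The scales whose popular target is \<open>s\<close>; only there is
    \<open>Q k\<close> known to fill the proportion \<open>1 / l\<close> of the window.\<close>
  define K where "K = {k. \<tau> k = s}"
  define Q where "Q k = {q \<in> J k. \<gamma> q = s}" for k
  define P where "P k = good_points (2 ^ k) (2 ^ (k - h)) (Q k) s" for k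
  have QJ: "Q k \<subseteq> {2 ^ k..<2 ^ k + 2 ^ (k - h)}" for k by (auto simp: Q_def J_def)
  define c where "c = 1 / (4 * real l * 2 ^ h)"
  have null: "negligible (- (\<Inter>n. \<Union>k\<in>K \<inter> {n..}. \<Union>x\<in>P k. ball x (\<rho> k)))"
  proof (rule ubiquity_negligible[OF _ _ _ \<rho>])
    show "c > 0" using l by (simp add: c_def)
    show "1 / (8 * 4 ^ k) \<le> \<bar>x - y\<bar>" if "x \<in> P k" "y \<in> P k" "x \<noteq> y" for k x y
    proof -
      have "1 / (8 * real (2 ^ k) ^ 2) \<le> \<bar>x - y\<bar>"
        by (rule good_points_separated[OF _ _ QJ]) (use that in \<open>auto simp: P_def\<close>)
      then show ?thesis by (simp add: power2_eq_square flip: power_mult_distrib)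
    qed
    show "\<forall>\<^sub>F k in sequentially. k \<in> K \<longrightarrow> c * 4 ^ k * (\<beta> - \<alpha>) \<le> card (P k \<inter> {\<alpha><..<\<beta>})"
      if "\<alpha> < \<beta>" for \<alpha> \<beta>
      using good_points_dyadic_card[OF l h that]
    proof eventually_elim
      case (elim k)
      have "2 ^ (k - h) \<le> l * card (Q k)" if "k \<in> K"
        using \<tau>(2)[of k] that by (simp add: K_def Q_def J_def)
      then show ?case using elim QJ[of k] unfolding c_def P_def by blast
    qed
    show "\<not> summable (\<lambda>k. if k \<in> K then 4 ^ k * \<rho> k else 0)" using s(2) by (simp add: K_def)
  qed
  let ?W = "W (\<lambda>q. indicator {q. q \<ge> 1 \<and> \<gamma> q = s} q * \<psi> q) \<gamma>"
  have psi_mono: "\<psi> r \<le> \<psi> q" if "1 \<le> q" "q \<le> r" for q r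
    using that(2,1) by (induction rule: dec_induct) (auto intro: order_trans[OF psi_decreasing[unfolded Suc_eq_plus1[symmetric]]])
  \<comment> \<open>Multiplying by \<open>q\<close> turns the distance \<open>\<rho> k\<close>
    between \<open>x\<close> and \<open>y\<close> into at most
    \<open>\<psi> (2^(k+1)) \<le> \<psi> q\<close>.\<close>
  have near: "dist_to_int (real q * x - \<gamma> q) < \<psi> q"
    if q: "q \<in> Q k" "real q * y = of_int a + s" and "x \<in> ball y (\<rho> k)" for q k x y and a :: int
  proof -
    have "(2::nat) ^ (k - h) \<le> 2 ^ k" by simp
    moreover have "2 ^ k \<le> q" "q < 2 ^ k + 2 ^ (k - h)" using QJ[of k] q(1) by auto
    moreover have "(1::nat) \<le> 2 ^ k" by simp
    ultimately have qk: "q \<ge> 1" "q \<le> 2 ^ Suc k" unfolding power_Suc by linarith+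
    have "\<gamma> q = s" using q(1) by (simp add: Q_def)
    then have "real q * x - \<gamma> q - of_int a = real q * (x - y)" using q(2) by (simp add: algebra_simps)
    then have "dist_to_int (real q * x - \<gamma> q) \<le> \<bar>real q * (x - y)\<bar>" using dist_to_int_le by metis
    also have "\<dots> = real q * \<bar>x - y\<bar>" by (simp add: abs_mult)
    also have "\<dots> < real q * \<rho> k"
      using that(3) qk(1) by (simp add: dist_real_def abs_minus_commute)
    also have "\<dots> \<le> 2 ^ Suc k * (\<psi> (2 ^ Suc k) / 2 ^ Suc k)"
    proof (rule mult_mono)
      show "real q \<le> 2 ^ Suc k" using of_nat_mono[OF qk(2), where 'a = real] by simp
    qed (use \<rho>[of k] in \<open>auto simp: \<rho>_def\<close>)
    also have "\<dots> = \<psi> (2 ^ Suc k)" by simp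
    also have "\<dots> \<le> \<psi> q" using qk by (intro psi_mono)
    finally show ?thesis .
  qed
  have sub: "{0..1} \<inter> (\<Inter>n. \<Union>k\<in>K \<inter> {n..}. \<Union>x\<in>P k. ball x (\<rho> k)) \<subseteq> ?W"
  proof
    fix x assume x: "x \<in> {0..1} \<inter> (\<Inter>n. \<Union>k\<in>K \<inter> {n..}. \<Union>x\<in>P k. ball x (\<rho> k))"
    have "\<exists>q>m. q \<ge> 1 \<and> dist_to_int (real q * x - \<gamma> q) < indicator {q. q \<ge> 1 \<and> \<gamma> q = s} q * \<psi> q" for m
    proof -
      obtain k y where k: "m \<le> k" and y: "y \<in> P k" "x \<in> ball y (\<rho> k)" using x by blast
      obtain q a where q: "q \<in> Q k" "real q * y = of_int a + s"
        using y(1) unfolding P_def good_points_def by blast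
      \<comment> \<open>Membership in every tail gives arbitrarily large scales, hence arbitrarily
        large \<open>q\<close>.\<close>
      have "k < 2 ^ k" "2 ^ k \<le> q" using QJ[of k] q(1) by auto
      then have "q > m" "q \<ge> 1" using k by linarith+
      moreover have "\<gamma> q = s" using q(1) by (simp add: Q_def)
      ultimately show ?thesis using near[OF q y(2)] by auto
    qed
    then show "x \<in> ?W" using x unfolding W_def by (simp add: infinite_nat_iff_unbounded)
  qed
  have neg: "negligible ({0..1} - ?W)"
    by (rule negligible_subset[OF null]) (use sub in blast)
  have "?W \<subseteq> W \<psi> \<gamma>"
  proof
    fix x assume x: "x \<in> ?W"
    \<comment> \<open>Where \<open>\<gamma> q\<close> differs from \<open>s\<close> the restricted
      function is 0, and no distance is negative, so such \<open>q\<close> are never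
      counted.\<close>
    have nn: "\<not> dist_to_int z < 0" for z by (simp add: dist_to_int_def infdist_nonneg not_less)
    have "{q. q \<ge> 1 \<and> dist_to_int (real q * x - \<gamma> q) < indicator {q. q \<ge> 1 \<and> \<gamma> q = s} q * \<psi> q}
      \<subseteq> {q. q \<ge> 1 \<and> dist_to_int (real q * x - \<gamma> q) < \<psi> q}"
      using nn by (auto simp: indicator_def split: if_splits)
    then show "x \<in> W \<psi> \<gamma>" using x unfolding W_def by (auto dest: infinite_super)
  qed
  then have "negligible ({0..1} - W \<psi> \<gamma>)" by (intro negligible_subset[OF neg]) blast
  then have "emeasure lebesgue (W \<psi> \<gamma>) = 1"
    by (intro emeasure_lebesgue_unit_interval_eq_1) (auto simp: W_def)
  moreover have "emeasure lebesgue ?W = 1"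
    using neg by (intro emeasure_lebesgue_unit_interval_eq_1) (auto simp: W_def)
  ultimately show ?thesis using s(1) by blast
qed

end
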